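(* Suppose that $\diamondsuit$ holds. Then there exists a linear order which is $2$-entangled and not separable.
   Context: $\diamondsuit$ is Jensen's diamond principle on $\omega_1$. A linear order is separable if it has a countable subset meeting every nonempty open interval (in the order topology). For a linear order $(L,\le)$ and pairs $e,e'$ of elements of $L$, $t(e,e') \in {}^2 2$ is defined by $t(e,e')_i = 1$ iff $e'_i < e_i$; for $t\in{}^22$, $\neg t = \langle 1-t_0,1-t_1\rangle$; $e,e'$ realize $t$ if $t(e,e')\in\{t,\neg t\}$. A pair is 1-1 if its entries are distinct; two pairs are disjoint if they share no entry. $L$ is $2$-entangled if $|L|\ge\aleph_1$ and for every collection $F$ of size $\aleph_1$ of 1-1, mutually disjoint pairs of elements of $L$ and every $t\in{}^22$, two distinct elements of $F$ realize $t$. *)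

theory Defs
  imports Main "HOL-Library.Countable_Set"
begin

unbundle cardinal_syntax

text \<open>Linear orders are reflexive relations \<open>r\<close> with \<open>Linear_order r\<close>; their underlying set is
  \<open>Field r\<close>.\<close>

definition strictly_below :: "'a rel \<Rightarrow> 'a \<Rightarrow> 'a \<Rightarrow> bool" where
  "strictly_below r x y \<longleftrightarrow> (x, y) \<in> r \<and> x \<noteq> y"

text \<open>\<open>cardSuc natLeq\<close> is a well-order of minimal order type among those of uncountable
  cardinality, that is, a copy of the ordinal \<open>\<omega>\<^sub>1\<close>. The ordinal \<open>\<alpha> = {\<beta>. \<beta> < \<alpha>}\<close> is rendered as
  \<open>underS omega1 \<alpha>\<close>.\<close>

definition omega1 :: "nat set rel" where
  "omega1 = cardSuc natLeq"

text \<open>The two conditions on \<open>\<delta>\<close> below say that \<open>\<delta>\<close> is nonzero and that \<open>C \<inter> \<delta>\<close> is cofinal in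
  \<open>\<delta>\<close>; as the inequality \<open>\<alpha> < \<beta>\<close> is strict, \<open>\<delta>\<close> is then a limit.\<close>

definition club_omega1 :: "nat set set \<Rightarrow> bool" where
  "club_omega1 C \<longleftrightarrow>
     C \<subseteq> Field omega1 \<and>
     (\<forall>\<alpha>\<in>Field omega1. \<exists>\<beta>\<in>C. strictly_below omega1 \<alpha> \<beta>) \<and>
     (\<forall>\<delta>\<in>Field omega1.
        underS omega1 \<delta> \<noteq> {} \<and>
        (\<forall>\<alpha>\<in>underS omega1 \<delta>. \<exists>\<beta>\<in>C \<inter> underS omega1 \<delta>. strictly_below omega1 \<alpha> \<beta>)
        \<longrightarrow> \<delta> \<in> C)"

definition stationary_omega1 :: "nat set set \<Rightarrow> bool" where
  "stationary_omega1 S \<longleftrightarrow> S \<subseteq> Field omega1 \<and> (\<forall>C. club_omega1 C \<longrightarrow> S \<inter> C \<noteq> {})"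

definition diamond :: bool where
  "diamond \<longleftrightarrow>
     (\<exists>A :: nat set \<Rightarrow> nat set set.
        (\<forall>\<alpha>\<in>Field omega1. A \<alpha> \<subseteq> underS omega1 \<alpha>) \<and>
        (\<forall>X. X \<subseteq> Field omega1 \<longrightarrow>
           stationary_omega1 {\<alpha> \<in> Field omega1. X \<inter> underS omega1 \<alpha> = A \<alpha>}))"

text \<open>The open intervals are the basic open sets of the order topology: bounded intervals, open
  rays, and the whole order.\<close>

definition open_intervals :: "'a rel \<Rightarrow> 'a set set" where
  "open_intervals r =
     {{x \<in> Field r. strictly_below r a x \<and> strictly_below r x b} | a b. a \<in> Field r \<and> b \<in> Field r} \<union>
     {{x \<in> Field r. strictly_below r a x} | a. a \<in> Field r} \<union>
     {{x \<in> Field r. strictly_below r x b} | b. b \<in> Field r} \<union>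
     {Field r}"

definition separable_order :: "'a rel \<Rightarrow> bool" where
  "separable_order r \<longleftrightarrow>
     (\<exists>D. D \<subseteq> Field r \<and> countable D \<and> (\<forall>I\<in>open_intervals r. I \<noteq> {} \<longrightarrow> D \<inter> I \<noteq> {}))"

text \<open>A type \<open>t \<in> \<^sup>22\<close> is a pair of truth values, \<open>True\<close> standing for \<open>1\<close>.\<close>

definition pair_type :: "'a rel \<Rightarrow> 'a \<times> 'a \<Rightarrow> 'a \<times> 'a \<Rightarrow> bool \<times> bool" where
  "pair_type r e e' = (strictly_below r (fst e') (fst e), strictly_below r (snd e') (snd e))"

definition neg_type :: "bool \<times> bool \<Rightarrow> bool \<times> bool" where
  "neg_type t = (\<not> fst t, \<not> snd t)"

definition realize :: "'a rel \<Rightarrow> 'a \<times> 'a \<Rightarrow> 'a \<times> 'a \<Rightarrow> bool \<times> bool \<Rightarrow> bool" where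
  "realize r e e' t \<longleftrightarrow> pair_type r e e' \<in> {t, neg_type t}"

definition one_one_pair :: "'a \<times> 'a \<Rightarrow> bool" where
  "one_one_pair e \<longleftrightarrow> fst e \<noteq> snd e"

definition disjoint_pairs :: "'a \<times> 'a \<Rightarrow> 'a \<times> 'a \<Rightarrow> bool" where
  "disjoint_pairs e e' \<longleftrightarrow> {fst e, snd e} \<inter> {fst e', snd e'} = {}"

definition two_entangled :: "'a rel \<Rightarrow> bool" where
  "two_entangled r \<longleftrightarrow>
     omega1 \<le>o |Field r| \<and>
     (\<forall>F t. F \<subseteq> Field r \<times> Field r \<and> |F| =o omega1 \<and>
        (\<forall>e\<in>F. one_one_pair e) \<and>
        (\<forall>e\<in>F. \<forall>e'\<in>F. e \<noteq> e' \<longrightarrow> disjoint_pairs e e')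
        \<longrightarrow> (\<exists>e\<in>F. \<exists>e'\<in>F. e \<noteq> e' \<and> realize r e e' t))"

end

theory Submission
  imports Defs Complex_Main "HOL-Library.Fun_Lexorder" "HOL-Library.Countable_Set_Type"
begin

text \<open>
  The line consists of functions \<open>\<omega>\<^sub>1 \<rightarrow> \<rat>\<close>, ordered lexicographically, each of them nonzero exactly
  below its height; under end extension they form an \<open>\<omega>\<^sub>1\<close>-tree with countable levels. At a limit
  \<open>\<delta>\<close>, diamond guesses a set \<open>A\<close> of pairs of nodes of height below \<open>\<delta>\<close>. The branches forming level
  \<open>\<delta>\<close> are chosen generically, so that any two of them (or one taken twice) either have initial
  segments with no extension in \<open>A\<close>, or form with some \<open>(p, q) \<in> A\<close> a realization of the given type,
  and keep doing so however they are extended. For distinct branches one simply extends \<open>p\<close> and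
  \<open>q\<close> by a positive or negative value; for a single branch one leaves the common part of \<open>p\<close> and
  \<open>q\<close> with a value beyond or strictly between the values of \<open>p\<close> and \<open>q\<close>.

  Let \<open>F\<close> be an uncountable disjoint family of pairs, guessed at a \<open>\<delta>\<close> closed under choosing members of
  \<open>F\<close> above given nodes. Some pair in \<open>F\<close> has both entries of height at least \<open>\<delta>\<close>. The first
  alternative fails at the branches below them, by closure of \<open>\<delta>\<close>, and the second one is the claim.
  Separability fails since the nodes above a given node form a convex set with nonempty
  interior, disjoint from any countable set of smaller heights.
\<close>

section \<open>Cardinality of \<open>omega1\<close> and of its initial segments\<close>

lemma Card_order_omega1: "Card_order omega1"
  unfolding omega1_def by (rule cardSuc_Card_order[OF natLeq_Card_order])

lemma Well_order_omega1: "Well_order omega1"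
  using Card_order_omega1 by (rule card_order_on_well_order_on)

text \<open>As the cardinal successor of \<open>natLeq\<close>, \<open>omega1\<close> lies below
  exactly those cardinals that exceed \<open>natLeq\<close>.\<close>

lemma omega1_ordLeq_card_of_iff: "omega1 \<le>o |A| \<longleftrightarrow> uncountable A"
  unfolding omega1_def countable_card_le_natLeq
  using cardSuc_ordLess_ordLeq[OF natLeq_Card_order card_of_Card_order, of A]
    not_ordLeq_iff_ordLess[OF natLeq_Well_order card_of_Well_order, of A]
  by blast

lemma uncountable_Field_omega1: "uncountable (Field omega1)"
  using card_of_Field_ordIso[OF Card_order_omega1] omega1_ordLeq_card_of_iff
    ordIso_iff_ordLeq by blast

lemma countable_underS_omega1:
  assumes "a \<in> Field omega1"
  shows "countable (underS omega1 a)"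
  using card_of_underS[OF Card_order_omega1 assms]
  unfolding countable_card_le_natLeq omega1_def
  using cardSuc_ordLeq_ordLess[OF natLeq_Card_order card_of_Card_order] by blast

subsection \<open>The ordinal \<open>\<omega>\<^sub>1\<close> as a type\<close>

text \<open>As a type of class \<open>wellorder\<close>, the field of \<open>omega1\<close> can
  index the functions compared by \<open>less_fun\<close>, and \<open>LEAST\<close> and well-founded
  recursion become available.\<close>

typedef om1 = "Field omega1"
  using uncountable_Field_omega1 by (metis countable_empty ex_in_conv)

instantiation om1 :: wellorder
begin

definition less_eq_om1 :: "om1 \<Rightarrow> om1 \<Rightarrow> bool" where
  "less_eq_om1 x y \<longleftrightarrow> (Rep_om1 x, Rep_om1 y) \<in> omega1"

definition less_om1 :: "om1 \<Rightarrow> om1 \<Rightarrow> bool" where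
  "less_om1 x y \<longleftrightarrow> strictly_below omega1 (Rep_om1 x) (Rep_om1 y)"

instance
proof
  note wo = Well_order_omega1[unfolded order_on_defs]
  have refl: "x \<le> x" for x :: om1
    using wo Rep_om1[of x] by (simp add: less_eq_om1_def refl_on_def)
  have antisym: "x = y" if "x \<le> y" "y \<le> x" for x y :: om1
    using wo that unfolding less_eq_om1_def by (metis Rep_om1_inject antisymD)
  fix x y z :: om1
  show "x \<le> x"
    by (rule refl)
  show "x = y" if "x \<le> y" "y \<le> x"
    using that by (rule antisym)
  show "x < y \<longleftrightarrow> x \<le> y \<and> \<not> y \<le> x"
    using refl[of x] antisym[of x y]
    by (auto simp: less_om1_def less_eq_om1_def strictly_below_def Rep_om1_inject)
  show "x \<le> z" if "x \<le> y" "y \<le> z"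
    using wo that unfolding less_eq_om1_def by (metis transD)
  show "x \<le> y \<or> y \<le> x"
    using wo Rep_om1[of x] Rep_om1[of y] refl[of x] unfolding less_eq_om1_def total_on_def
    by metis
next
  fix P :: "om1 \<Rightarrow> bool" and a
  assume step: "\<And>x. (\<And>y. y < x \<Longrightarrow> P y) \<Longrightarrow> P x"
  have "wf (inv_image (omega1 - Id) Rep_om1)"
    using Well_order_omega1 by (simp add: well_order_on_def)
  then show "P a"
    by (induction a rule: wf_induct_rule)
      (rule step, auto simp: less_om1_def strictly_below_def)
qed

end

lemma range_Rep_om1: "range Rep_om1 = Field omega1"
  by (rule type_definition.Rep_range[OF type_definition_om1])

lemma underS_Rep_om1: "underS omega1 (Rep_om1 a) = Rep_om1 ` {..<a}"
proof -
  have "underS omega1 (Rep_om1 a) \<subseteq> range Rep_om1"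
    unfolding range_Rep_om1 by (auto simp: underS_def Field_def)
  moreover have "Rep_om1 x \<in> underS omega1 (Rep_om1 a) \<longleftrightarrow> x < a" for x
    by (auto simp: underS_def less_om1_def strictly_below_def)
  ultimately show ?thesis
    by auto
qed

lemma uncountable_om1: "uncountable (UNIV :: om1 set)"
  using uncountable_Field_omega1 countable_image[of UNIV Rep_om1]
  unfolding range_Rep_om1 by blast

lemma countable_lessThan_om1: "countable {..<a::om1}"
  using countable_underS_omega1[OF Rep_om1[of a]]
  unfolding underS_Rep_om1
  by (rule countable_image_inj_on) (simp add: inj_on_def Rep_om1_inject)

lemma countable_atMost_om1: "countable {..a::om1}"
  using countable_lessThan_om1[of a] by (simp flip: ivl_disj_un_singleton(2))

text \<open>Otherwise the whole type would be a countable union of countable initial segments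
  \<open>{..a}\<close>.\<close>

lemma countable_bounded_om1:
  fixes A :: "om1 set"
  assumes "countable A"
  shows "\<exists>b. \<forall>a\<in>A. a < b"
proof (rule ccontr)
  assume "\<not> ?thesis"
  then have "UNIV = (\<Union>a\<in>A. {..a})"
    by (auto simp: not_less)
  then show False
    using assms countable_atMost_om1 uncountable_om1 by (metis countable_UN)
qed

definition succ_om1 :: "om1 \<Rightarrow> om1" where
  "succ_om1 a = (LEAST b. a < b)"

lemma less_succ_om1_iff: "b < succ_om1 a \<longleftrightarrow> b \<le> a"
proof -
  have "\<exists>b. a < b"
    using countable_bounded_om1[of "{a}"] by auto
  then have "a < succ_om1 a"
    unfolding succ_om1_def by (rule LeastI_ex)
  moreover have "b \<le> a" if "b < succ_om1 a"
    using not_less_Least[OF that[unfolded succ_om1_def]] by simp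
  ultimately show ?thesis
    by auto
qed

text \<open>Let \<open>g x\<close> bound \<open>x\<close> and all \<open>H b\<close> with
  \<open>b \<le> x\<close>, and let \<open>d\<close> be the supremum of the iterates of
  \<open>g\<close> from \<open>a\<close>. Each \<open>b < d\<close> lies at or below some iterate,
  so \<open>H b\<close> lies below the next one.\<close>

lemma closure_point_om1:
  fixes H :: "om1 \<Rightarrow> om1 set"
  assumes H: "\<And>b. countable (H b)"
  shows "\<exists>d>a. \<forall>b<d. H b \<subseteq> {..<d}"
proof -
  have "\<exists>y>x. \<forall>b\<le>x. H b \<subseteq> {..<y}" for x
  proof -
    have "countable (insert x (\<Union>b\<in>{..x}. H b))"
      using H countable_atMost_om1 by simp
    from countable_bounded_om1[OF this] show ?thesis
      by fastforce
  qed
  then obtain g where g: "\<And>x. x < g x" "\<And>x b. b \<le> x \<Longrightarrow> H b \<subseteq> {..<g x}"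
    by metis
  define s where "s n = (g ^^ n) a" for n
  have s_Suc: "s (Suc n) = g (s n)" for n
    by (simp add: s_def)
  define d where "d = (LEAST d. \<forall>n. s n < d)"
  have "\<exists>d. \<forall>n. s n < d"
    using countable_bounded_om1[of "range s"] by auto
  then have d: "s n < d" for n
    unfolding d_def using LeastI_ex[where P = "\<lambda>d. \<forall>n. s n < d"] by blast
  have "H b \<subseteq> {..<d}" if "b < d" for b
  proof -
    from not_less_Least[OF that[unfolded d_def]] obtain n where "b \<le> s n"
      by (auto simp: not_less)
    from g(2)[OF this] show ?thesis
      using d[of "Suc n"] by (auto simp: s_Suc)
  qed
  moreover have "a < d"
    using d[of 0] by (simp add: s_def)
  ultimately show ?thesis
    by blast
qed

text \<open>A limit of closure points is one itself: any \<open>b\<close> below it lies below a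
  closure point \<open>c\<close>, and \<open>H b\<close> stays below \<open>c\<close>. Zero is left
  out, as it would meet the closure condition vacuously.\<close>

lemma club_closure_points:
  fixes H :: "om1 \<Rightarrow> om1 set"
  assumes H: "\<And>b. countable (H b)"
  shows "club_omega1 (Rep_om1 ` {d. (\<exists>b. b < d) \<and> (\<forall>b<d. H b \<subseteq> {..<d})})"
proof -
  let ?C = "{d. (\<exists>b. b < d) \<and> (\<forall>b<d. H b \<subseteq> {..<d})}"
  have unbounded: "\<exists>b\<in>?C. a < b" for a
    using closure_point_om1[of H, OF H] by blast
  have closed: "d \<in> ?C"
    if "{..<d} \<noteq> {}" "\<forall>a\<in>{..<d}. \<exists>b\<in>?C \<inter> {..<d}. a < b" for d
  proof -
    have "H b \<subseteq> {..<d}" if "b < d" for b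
    proof -
      from that obtain c where "c \<in> ?C" "c < d" "b < c"
        using \<open>\<forall>a\<in>_. _\<close> by blast
      then show ?thesis
        by fastforce
    qed
    then show ?thesis
      using that(1) by auto
  qed
  show ?thesis
    unfolding club_omega1_def
  proof (intro conjI ballI impI)
    show "Rep_om1 ` ?C \<subseteq> Field omega1"
      using Rep_om1 by auto
  next
    fix x assume "x \<in> Field omega1"
    then obtain a where "x = Rep_om1 a"
      by (metis Rep_om1_cases)
    then show "\<exists>y\<in>Rep_om1 ` ?C. strictly_below omega1 x y"
      using unbounded[of a] by (auto simp: less_om1_def)
  next
    fix x assume "x \<in> Field omega1"
    then obtain d where x: "x = Rep_om1 d"
      by (metis Rep_om1_cases)
    assume *: "underS omega1 x \<noteq> {} \<and> (\<forall>\<alpha>\<in>underS omega1 x.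
      \<exists>\<beta>\<in>Rep_om1 ` ?C \<inter> underS omega1 x. strictly_below omega1 \<alpha> \<beta>)"
    have "\<exists>b\<in>?C \<inter> {..<d}. a < b" if "a < d" for a
    proof -
      have "Rep_om1 a \<in> underS omega1 x"
        using that by (auto simp: x underS_Rep_om1)
      with * have "\<exists>y\<in>Rep_om1 ` ?C \<inter> underS omega1 x. strictly_below omega1 (Rep_om1 a) y"
        by blast
      then obtain y where "y \<in> Rep_om1 ` ?C" "y \<in> Rep_om1 ` {..<d}"
        "strictly_below omega1 (Rep_om1 a) y"
        unfolding x underS_Rep_om1 by blast
      then show ?thesis
        by (auto simp: less_om1_def Rep_om1_inject)
    qed
    then have "d \<in> ?C"
      using * by (intro closed) (auto simp: x underS_Rep_om1)
    then show "x \<in> Rep_om1 ` ?C"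
      by (simp add: x)
  qed
qed

text \<open>The closure points of \<open>H\<close> form a club, so the stationary set of correct
  guesses contains one of them. The guesses are pulled back along \<open>Rep_om1\<close>.\<close>

lemma diamond_om1:
  assumes diamond
  shows "\<exists>A :: om1 \<Rightarrow> om1 set. \<forall>X H. (\<forall>b. countable (H b)) \<longrightarrow>
    (\<exists>d. (\<exists>b. b < d) \<and> (\<forall>b<d. H b \<subseteq> {..<d}) \<and> X \<inter> {..<d} = A d \<inter> {..<d})"
proof -
  from assms obtain A where A: "\<And>X. X \<subseteq> Field omega1 \<Longrightarrow>
      stationary_omega1 {\<alpha> \<in> Field omega1. X \<inter> underS omega1 \<alpha> = A \<alpha>}"
    unfolding diamond_def by blast
  have "\<exists>d. (\<exists>b. b < d) \<and> (\<forall>b<d. H b \<subseteq> {..<d}) \<and>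
      X \<inter> {..<d} = Rep_om1 -` A (Rep_om1 d) \<inter> {..<d}"
    if "\<forall>b. countable (H b)" for X and H :: "om1 \<Rightarrow> om1 set"
  proof -
    have "Rep_om1 ` X \<subseteq> Field omega1"
      using Rep_om1 by auto
    from A[OF this] club_closure_points[of H] that
    have "{\<alpha> \<in> Field omega1. Rep_om1 ` X \<inter> underS omega1 \<alpha> = A \<alpha>} \<inter>
        Rep_om1 ` {d. (\<exists>b. b < d) \<and> (\<forall>b<d. H b \<subseteq> {..<d})} \<noteq> {}"
      unfolding stationary_omega1_def by blast
    then obtain d where d: "\<exists>b. b < d" "\<forall>b<d. H b \<subseteq> {..<d}"
      "Rep_om1 ` X \<inter> Rep_om1 ` {..<d} = A (Rep_om1 d)"
      unfolding underS_Rep_om1[symmetric] by blast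
    then have "X \<inter> {..<d} = Rep_om1 -` A (Rep_om1 d) \<inter> {..<d}"
      by (auto simp flip: d(3) simp: Rep_om1_inject)
    with d show ?thesis
      by blast
  qed
  then show ?thesis
    by (intro exI[of _ "\<lambda>d. Rep_om1 -` A (Rep_om1 d)"]) blast
qed

subsection \<open>Lexicographic order and end extension\<close>

lemma less_fun_iff_at:
  fixes x y :: "'a::linorder \<Rightarrow> 'b::linorder"
  assumes "x k \<noteq> y k" "\<And>j. j < k \<Longrightarrow> x j = y j"
  shows "less_fun x y \<longleftrightarrow> x k < y k"
proof
  assume "less_fun x y"
  then obtain l where l: "x l < y l" "\<forall>j<l. x j = y j"
    unfolding less_fun_def by blast
  have "\<not> l < k" "\<not> k < l"
    using assms l by auto
  then have "l = k"
    by simp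
  with l show "x k < y k"
    by simp
next
  assume "x k < y k"
  with assms(2) show "less_fun x y"
    unfolding less_fun_def by blast
qed

lemma first_difference:
  fixes x y :: "'a::wellorder \<Rightarrow> 'b"
  assumes "x \<noteq> y"
  shows "\<exists>k. x k \<noteq> y k \<and> (\<forall>j<k. x j = y j)"
proof -
  let ?k = "LEAST k. x k \<noteq> y k"
  from assms have "\<exists>k. x k \<noteq> y k"
    by (simp add: fun_eq_iff)
  then have "x ?k \<noteq> y ?k"
    by (rule LeastI_ex[of "\<lambda>k. x k \<noteq> y k"])
  moreover have "x j = y j" if "j < ?k" for j
    using not_less_Least[OF that] by simp
  ultimately show ?thesis
    by blast
qed

lemma less_fun_total:
  fixes x y :: "'a::wellorder \<Rightarrow> 'b::linorder"
  assumes "x \<noteq> y"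
  shows "less_fun x y \<or> less_fun y x"
proof -
  obtain k where "x k \<noteq> y k" "\<forall>j<k. x j = y j"
    using first_difference[OF assms] by blast
  then show ?thesis
    unfolding less_fun_def by (metis linorder_neqE)
qed

text \<open>The value 0 marks the places where a function counts as undefined, so this is inclusion
  of partial functions.\<close>

definition end_extends :: "('a \<Rightarrow> rat) \<Rightarrow> ('a \<Rightarrow> rat) \<Rightarrow> bool" (infix \<open>\<sqsubseteq>\<close> 50) where
  "s \<sqsubseteq> x \<longleftrightarrow> (\<forall>a. s a \<noteq> 0 \<longrightarrow> x a = s a)"

definition height :: "('a::linorder \<Rightarrow> rat) \<Rightarrow> 'a \<Rightarrow> bool" where
  "height x a \<longleftrightarrow> (\<forall>b. x b \<noteq> 0 \<longleftrightarrow> b < a)"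

lemma end_extends_refl: "x \<sqsubseteq> x"
  by (simp add: end_extends_def)

lemma end_extends_trans: "x \<sqsubseteq> y \<Longrightarrow> y \<sqsubseteq> z \<Longrightarrow> x \<sqsubseteq> z"
  by (simp add: end_extends_def)

lemma height_unique: "height x a \<Longrightarrow> height x b \<Longrightarrow> a = b"
  unfolding height_def using linorder_less_linear[of a b] by blast

text \<open>At the first place \<open>b\<close> where \<open>y\<close> departs from
  \<open>s\<close>, both \<open>x\<close> and \<open>z\<close> still have the value
  \<open>s b\<close> and agree with \<open>y\<close> below \<open>b\<close>. The two comparisons
  would then give \<open>s b < y b\<close> and \<open>y b < s b\<close>.\<close>

lemma less_fun_convex:
  fixes x y z :: "'a::wellorder \<Rightarrow> rat"
  assumes "height s a" "s \<sqsubseteq> x" "s \<sqsubseteq> z" "less_fun x y" "less_fun y z"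
  shows "s \<sqsubseteq> y"
proof (rule ccontr)
  let ?P = "\<lambda>b. s b \<noteq> 0 \<and> y b \<noteq> s b"
  define b where "b = (LEAST b. ?P b)"
  assume "\<not> s \<sqsubseteq> y"
  then have "\<exists>b. ?P b"
    by (auto simp: end_extends_def)
  then have b: "s b \<noteq> 0" "y b \<noteq> s b"
    unfolding b_def using LeastI_ex[of ?P] by blast+
  have below: "y c = s c" "s c \<noteq> 0" if "c < b" for c
  proof -
    show "s c \<noteq> 0"
      using assms(1) b(1) that unfolding height_def by (metis less_trans)
    then show "y c = s c"
      using not_less_Least[of c ?P] that unfolding b_def by blast
  qed
  have xz: "x b = s b" "z b = s b" "\<And>c. c < b \<Longrightarrow> x c = s c \<and> z c = s c"
    using assms(2,3) b below unfolding end_extends_def by simp_all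
  have "x b < y b"
    using less_fun_iff_at[of x b y] xz below b assms(4) by simp
  moreover have "y b < z b"
    using less_fun_iff_at[of y b z] xz below b assms(5) by simp
  ultimately show False
    using xz by simp
qed

text \<open>If \<open>x\<close> is nonzero below \<open>a\<close> and \<open>k \<noteq> 0\<close>,
  this is an immediate successor, in the tree order, of the restriction of \<open>x\<close> to
  \<open>a\<close>.\<close>

definition truncate :: "('a::linorder \<Rightarrow> rat) \<Rightarrow> 'a \<Rightarrow> rat \<Rightarrow> 'a \<Rightarrow> rat" where
  "truncate x a k = (\<lambda>b. if b < a then x b else if b = a then k else 0)"

text \<open>The functions \<open>x\<close> and \<open>y\<close> agree below \<open>a\<close>, and
  \<open>y a = k\<close> is their first difference. When \<open>a\<close> is the height of
  \<open>x\<close>, the value \<open>x a\<close> is 0 and the sign of \<open>k\<close>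
  decides.\<close>

lemma less_fun_truncate_iff:
  fixes x y :: "'a::linorder \<Rightarrow> rat"
  assumes "\<And>b. b < a \<Longrightarrow> x b \<noteq> 0" "k \<noteq> 0" "k \<noteq> x a" "truncate x a k \<sqsubseteq> y"
  shows "less_fun x y \<longleftrightarrow> x a < k"
proof -
  have "y b = x b" if "b < a" for b
    using assms(1)[OF that] assms(4) that by (auto simp: end_extends_def truncate_def)
  moreover have "y a = k"
    using assms(2,4) by (auto simp: end_extends_def truncate_def)
  ultimately show ?thesis
    using less_fun_iff_at[of x a y] assms(3) by simp
qed

text \<open>The limit is the union of the chain, whose members agree wherever two of them are
  nonzero. The second property keeps the union from being nonzero elsewhere, so that its height can
  be computed.\<close>

lemma end_extends_chain_limit:
  fixes s :: "nat \<Rightarrow> 'a \<Rightarrow> rat"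
  assumes "\<And>i j. i \<le> j \<Longrightarrow> s i \<sqsubseteq> s j"
  obtains x where "\<And>i. s i \<sqsubseteq> x" "\<And>a. x a \<noteq> 0 \<Longrightarrow> \<exists>i. s i a \<noteq> 0"
proof -
  have coherent: "s i a = s j a" if "s i a \<noteq> 0" "s j a \<noteq> 0" for i j a
    using assms[of i j] assms[of j i] that nat_le_linear[of i j]
    unfolding end_extends_def by auto
  have "\<exists>c. \<forall>i. (s i a \<noteq> 0 \<longrightarrow> c = s i a) \<and> (c \<noteq> 0 \<longrightarrow> (\<exists>i. s i a \<noteq> 0))" for a
  proof (cases "\<exists>i. s i a \<noteq> 0")
    case True
    then obtain i where "s i a \<noteq> 0"
      by blast
    with coherent[of i a] show ?thesis
      by (intro exI[of _ "s i a"]) blast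
  qed auto
  then obtain x where x: "\<And>a i. s i a \<noteq> 0 \<Longrightarrow> x a = s i a"
    "\<And>a. x a \<noteq> 0 \<Longrightarrow> \<exists>i. s i a \<noteq> 0"
    by metis
  then show ?thesis
    by (intro that[of x]) (simp_all add: end_extends_def)
qed

text \<open>Up to negation a type records only whether its two coordinates agree, so two cases have
  to be met instead of four.\<close>

lemma mem_type_neg_type_iff: "(b, c) \<in> {t, neg_type t} \<longleftrightarrow> (b = c) = (fst t = snd t)"
  by (cases t) (auto simp: neg_type_def)

lemma rat_realizing_type:
  fixes a b :: rat
  assumes "a \<noteq> b"
  obtains k where "k \<noteq> 0" "k \<noteq> a" "k \<noteq> b" "(a < k, b < k) \<in> {t, neg_type t}"
proof (cases "fst t = snd t")
  case True
  let ?k = "\<bar>a\<bar> + \<bar>b\<bar> + 1"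
  have "?k \<noteq> 0" "a < ?k" "b < ?k"
    by linarith+
  then show ?thesis
    by (intro that[of ?k]) (unfold mem_type_neg_type_iff, use True in simp_all)
next
  case False
  have "min a b < max a b"
    using assms by simp
  \<comment> \<open>Two intermediate points are taken because one of them may be 0, which is not an
    admissible value.\<close>
  then obtain c d where cd: "min a b < c" "c < d" "d < max a b"
    using dense by metis
  define k where "k = (if c = 0 then d else c)"
  have k: "k \<noteq> 0" "min a b < k" "k < max a b"
    using cd by (auto simp: k_def)
  then have "(a < k) \<noteq> (b < k)" "k \<noteq> a" "k \<noteq> b"
    by linarith+
  with k show ?thesis
    by (intro that[of k]) (unfold mem_type_neg_type_iff, use False in simp_all)
qed

subsection \<open>Generic branches\<close>

text \<open>Both alternatives persist when \<open>x\<close> and \<open>y\<close> are end-extended,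
  so settling them at one level settles them for all nodes above. The pair
  \<open>(less_fun p x', less_fun q y')\<close> is the \<open>pair_type\<close> of
  \<open>(x', y')\<close> and \<open>(p, q)\<close>.\<close>

definition sealed :: "(('a::wellorder \<Rightarrow> rat) \<times> ('a \<Rightarrow> rat)) set \<Rightarrow> ('a \<Rightarrow> rat) set \<Rightarrow>
    ('a \<Rightarrow> rat) \<Rightarrow> ('a \<Rightarrow> rat) \<Rightarrow> bool \<times> bool \<Rightarrow> bool" where
  "sealed A T x y t \<longleftrightarrow>
    (\<exists>s\<in>T. \<exists>s'\<in>T. s \<sqsubseteq> x \<and> s' \<sqsubseteq> y \<and> \<not> (\<exists>p q. (p, q) \<in> A \<and> s \<sqsubseteq> p \<and> s' \<sqsubseteq> q)) \<or>
    (\<exists>p q. (p, q) \<in> A \<and>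
      (\<forall>x' y'. x \<sqsubseteq> x' \<longrightarrow> y \<sqsubseteq> y' \<longrightarrow> (less_fun p x', less_fun q y') \<in> {t, neg_type t}))"

text \<open>The Rasiowa-Sikorski argument: step \<open>n\<close> of the chain enters the
  \<open>n\<close>-th of the countably many dense sets.\<close>

lemma generic_chain:
  fixes R :: "'s \<Rightarrow> 's \<Rightarrow> bool"
  assumes refl: "\<And>s. R s s" and trans: "\<And>r s t. R r s \<Longrightarrow> R s t \<Longrightarrow> R r t"
    and "countable \<D>" and dense: "\<And>D s. D \<in> \<D> \<Longrightarrow> s \<in> S \<Longrightarrow> \<exists>s'\<in>S \<inter> D. R s s'"
    and "s0 \<in> S"
  shows "\<exists>s :: nat \<Rightarrow> 's. s 0 = s0 \<and> (\<forall>i. s i \<in> S) \<and> (\<forall>i j. i \<le> j \<longrightarrow> R (s i) (s j)) \<and>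
    (\<forall>D\<in>\<D>. \<exists>i. s i \<in> D)"
proof -
  \<comment> \<open>The guard is there because \<open>from_nat_into\<close> enumerates only a
    nonempty family.\<close>
  have "\<exists>s'. s' \<in> S \<and> R s s' \<and> (\<D> \<noteq> {} \<longrightarrow> s' \<in> from_nat_into \<D> n)" if "s \<in> S" for s n
    using dense[OF from_nat_into that] that refl by (cases "\<D> = {}") blast+
  then have "\<exists>s. \<forall>n. (s n \<in> S \<and> (n = 0 \<longrightarrow> s n = s0)) \<and>
      (R (s n) (s (Suc n)) \<and> (\<D> \<noteq> {} \<longrightarrow> s (Suc n) \<in> from_nat_into \<D> n))"
    using \<open>s0 \<in> S\<close> by (intro dependent_nat_choice) auto
  then obtain s where s: "\<And>n. s n \<in> S" "s 0 = s0" "\<And>n. R (s n) (s (Suc n))"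
    "\<And>n. \<D> \<noteq> {} \<Longrightarrow> s (Suc n) \<in> from_nat_into \<D> n"
    by blast
  have "R (s i) (s j)" if "i \<le> j" for i j :: nat
    using that by (induction j rule: dec_induct) (auto intro: refl trans s(3))
  moreover have "\<exists>i. s i \<in> D" if "D \<in> \<D>" for D
    using s(4) that from_nat_into_surj[OF \<open>countable \<D>\<close> that] by blast
  ultimately show ?thesis
    using s(1,2) by (intro exI[of _ s]) simp
qed

text \<open>The type is only met up to negation: a value strictly between those of \<open>p\<close> and \<open>q\<close> leaves no
  choice which of the two is smaller.\<close>

lemma decide_one_branch:
  fixes p q s :: "'a::wellorder \<Rightarrow> rat"
  assumes "height s c" "height p a" "height q b" "s \<sqsubseteq> p" "s \<sqsubseteq> q" "p \<noteq> q"
  shows "\<exists>e k. k \<noteq> 0 \<and> (\<forall>b<e. p b \<noteq> 0) \<and> s \<sqsubseteq> truncate p e k \<and>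
    (\<forall>x y. truncate p e k \<sqsubseteq> x \<longrightarrow> truncate p e k \<sqsubseteq> y \<longrightarrow>
      (less_fun p x, less_fun q y) \<in> {t, neg_type t})"
proof -
  obtain e where e: "p e \<noteq> q e" "\<forall>j<e. p j = q j"
    using first_difference[OF \<open>p \<noteq> q\<close>] by blast
  have "e < a \<or> e < b"
    using e(1) assms(2,3) unfolding height_def by metis
  then have nonzero: "p j \<noteq> 0" "q j \<noteq> 0" if "j < e" for j
    using e(2) that less_trans[OF that] assms(2,3) unfolding height_def by metis+
  from e(1) obtain k where k: "k \<noteq> 0" "k \<noteq> p e" "k \<noteq> q e"
    "(p e < k, q e < k) \<in> {t, neg_type t}"
    by (rule rat_realizing_type)
  \<comment> \<open>As \<open>p\<close> and \<open>q\<close> agree below \<open>e\<close>, one and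
    the same node can be compared with both of them at \<open>e\<close>.\<close>
  have "truncate p e k = truncate q e k"
    using e(2) by (auto simp: truncate_def)
  then have "(less_fun p x, less_fun q y) \<in> {t, neg_type t}"
    if "truncate p e k \<sqsubseteq> x" "truncate p e k \<sqsubseteq> y" for x y
    using less_fun_truncate_iff[of e p k x] less_fun_truncate_iff[of e q k y] nonzero k that
    by simp
  \<comment> \<open>A common initial segment of \<open>p\<close> and \<open>q\<close> ends by the
    place \<open>e\<close> where they part, so leaving them there still extends
    \<open>s\<close>.\<close>
  moreover have "s e = 0"
    using e(1) assms(4,5) unfolding end_extends_def by metis
  then have "c \<le> e"
    using assms(1) unfolding height_def by (metis not_less)
  then have "s \<sqsubseteq> truncate p e k"
    using assms(1,4) unfolding end_extends_def truncate_def height_def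
    by (metis less_le_trans)
  ultimately show ?thesis
    using k(1) nonzero by blast
qed

text \<open>The two nodes are extended independently. Each has value 0 at its own height, so the
  sign of the value added there decides its comparison, and \<open>t\<close> itself is met, not only
  up to negation.\<close>

lemma decide_two_branches:
  fixes p q :: "'a::wellorder \<Rightarrow> rat"
  assumes "height p a" "height q b"
  shows "\<exists>k l. k \<noteq> 0 \<and> l \<noteq> 0 \<and>
    (\<forall>x y. truncate p a k \<sqsubseteq> x \<longrightarrow> truncate q b l \<sqsubseteq> y \<longrightarrow> (less_fun p x, less_fun q y) = t)"
proof -
  define k l :: rat where "k = (if fst t then 1 else -1)" and "l = (if snd t then 1 else -1)"
  have kl: "k \<noteq> 0" "l \<noteq> 0" "(0 < k, 0 < l) = t"
    by (auto simp: k_def l_def prod_eq_iff)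
  have "p a = 0" "\<And>e. e < a \<Longrightarrow> p e \<noteq> 0" "q b = 0" "\<And>e. e < b \<Longrightarrow> q e \<noteq> 0"
    using assms by (auto simp: height_def)
  then have "(less_fun p x, less_fun q y) = t"
    if "truncate p a k \<sqsubseteq> x" "truncate q b l \<sqsubseteq> y" for x y
    using less_fun_truncate_iff[of a p k x] less_fun_truncate_iff[of b q l y] kl that by simp
  with kl show ?thesis
    by blast
qed

lemma end_extends_truncate:
  assumes "height p a"
  shows "p \<sqsubseteq> truncate p a k"
  using assms by (auto simp: end_extends_def truncate_def height_def)

text \<open>The conditions are infinite sequences of nodes of \<open>T\<close>, ordered by end
  extension in every coordinate; the branches are the coordinatewise unions of a generic chain. Only
  countably many dense sets occur: those forcing coordinate \<open>n\<close> past
  \<open>a < d\<close>, and those deciding a pair of coordinates for a type.\<close>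

lemma generic_branches:
  fixes T :: "('a::wellorder \<Rightarrow> rat) set" and d :: 'a
  assumes seg: "countable {..<d}" and "countable T" "T \<noteq> {}"
    and T_height: "\<And>s. s \<in> T \<Longrightarrow> \<exists>a<d. height s a"
    and T_truncate: "\<And>s a k. s \<in> T \<Longrightarrow> (\<And>b. b < a \<Longrightarrow> s b \<noteq> 0) \<Longrightarrow> k \<noteq> 0 \<Longrightarrow> truncate s a k \<in> T"
    and T_extend: "\<And>s a. s \<in> T \<Longrightarrow> a < d \<Longrightarrow> \<exists>s'\<in>T. s \<sqsubseteq> s' \<and> s' a \<noteq> 0"
    and A: "\<And>p q. (p, q) \<in> A \<Longrightarrow> p \<in> T \<and> q \<in> T \<and> p \<noteq> q"
  shows "\<exists>v :: nat \<Rightarrow> 'a \<Rightarrow> rat. (\<forall>n. height (v n) d) \<and>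
    (\<forall>n. \<forall>a<d. \<exists>s\<in>T. s \<sqsubseteq> v n \<and> s a \<noteq> 0) \<and> (\<forall>s\<in>T. \<exists>n. s \<sqsubseteq> v n) \<and>
    (\<forall>m n t. sealed A T (v m) (v n) t)"
proof -
  define R :: "(nat \<Rightarrow> 'a \<Rightarrow> rat) \<Rightarrow> (nat \<Rightarrow> 'a \<Rightarrow> rat) \<Rightarrow> bool"
    where "R \<sigma> \<tau> \<longleftrightarrow> (\<forall>n. \<sigma> n \<sqsubseteq> \<tau> n)" for \<sigma> \<tau>
  define H :: "nat \<times> 'a \<Rightarrow> (nat \<Rightarrow> 'a \<Rightarrow> rat) set"
    where "H = (\<lambda>(n, a). {\<sigma>. \<sigma> n a \<noteq> 0})"
  \<comment> \<open>This asks of the current nodes \<open>\<sigma> m\<close> and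
    \<open>\<sigma> n\<close> what \<open>sealed\<close> will ask of the limit branches; in the
    first alternative these nodes become the initial segments \<open>s\<close> and
    \<open>s'\<close>.\<close>
  define G :: "nat \<times> nat \<times> bool \<times> bool \<Rightarrow> (nat \<Rightarrow> 'a \<Rightarrow> rat) set"
    where "G = (\<lambda>(m, n, t). {\<sigma>. \<not> (\<exists>p q. (p, q) \<in> A \<and> \<sigma> m \<sqsubseteq> p \<and> \<sigma> n \<sqsubseteq> q) \<or>
      (\<exists>p q. (p, q) \<in> A \<and> (\<forall>x y. \<sigma> m \<sqsubseteq> x \<longrightarrow> \<sigma> n \<sqsubseteq> y \<longrightarrow>
        (less_fun p x, less_fun q y) \<in> {t, neg_type t}))})"
  have G_I: "\<sigma> \<in> G (m, n, t)" if "(p, q) \<in> A"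
    "\<And>x y. \<sigma> m \<sqsubseteq> x \<Longrightarrow> \<sigma> n \<sqsubseteq> y \<Longrightarrow> (less_fun p x, less_fun q y) \<in> {t, neg_type t}"
    for \<sigma> m n t p q
    using that unfolding G_def prod.case mem_Collect_eq by blast
  let ?S = "{\<sigma>. \<forall>n. \<sigma> n \<in> T}"
  have H_dense: "\<exists>\<tau>\<in>?S \<inter> H (n, a). R \<sigma> \<tau>" if "a < d" "\<sigma> \<in> ?S" for \<sigma> n a
  proof -
    from that T_extend[of "\<sigma> n" a] obtain s where "s \<in> T" "\<sigma> n \<sqsubseteq> s" "s a \<noteq> 0"
      by blast
    then show ?thesis
      using that by (intro bexI[of _ "\<sigma>(n := s)"]) (auto simp: R_def H_def end_extends_refl)
  qed
  have G_dense: "\<exists>\<tau>\<in>?S \<inter> G (m, n, t). R \<sigma> \<tau>" if "\<sigma> \<in> ?S" for \<sigma> m n t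
  proof (cases "\<exists>p q. (p, q) \<in> A \<and> \<sigma> m \<sqsubseteq> p \<and> \<sigma> n \<sqsubseteq> q")
    case False
    then have "\<sigma> \<in> G (m, n, t)"
      by (auto simp: G_def)
    with that show ?thesis
      by (intro bexI[of _ \<sigma>]) (auto simp: R_def end_extends_refl)
  next
    case True
    then obtain p q where pq: "(p, q) \<in> A" "\<sigma> m \<sqsubseteq> p" "\<sigma> n \<sqsubseteq> q"
      by blast
    with A have "p \<in> T" "q \<in> T" "p \<noteq> q"
      by auto
    moreover have "\<sigma> m \<in> T"
      using that by simp
    ultimately obtain a b c where h: "height p a" "height q b" "height (\<sigma> m) c"
      using T_height by meson
    show ?thesis
    \<comment> \<open>If the coordinates coincide, a single new node must serve against both
      \<open>p\<close> and \<open>q\<close>; otherwise they are changed separately.\<close>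
    proof (cases "m = n")
      case True
      with pq(3) have "\<sigma> m \<sqsubseteq> q"
        by simp
      from decide_one_branch[OF h(3,1,2) pq(2) this \<open>p \<noteq> q\<close>, of t]
      obtain e k where ek: "k \<noteq> 0" "\<forall>b<e. p b \<noteq> 0" "\<sigma> m \<sqsubseteq> truncate p e k"
        "\<forall>x y. truncate p e k \<sqsubseteq> x \<longrightarrow> truncate p e k \<sqsubseteq> y \<longrightarrow>
          (less_fun p x, less_fun q y) \<in> {t, neg_type t}"
        by (elim exE conjE) (rule that)
      let ?\<tau> = "\<sigma>(m := truncate p e k)"
      have "truncate p e k \<in> T"
        using T_truncate \<open>p \<in> T\<close> ek(1,2) by blast
      then have "?\<tau> \<in> ?S"
        using that by simp
      moreover have "?\<tau> \<in> G (m, n, t)"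
        using ek(4) True by (intro G_I[OF pq(1)]) simp
      moreover have "R \<sigma> ?\<tau>"
        using ek(3) by (simp add: R_def end_extends_refl)
      ultimately show ?thesis
        by blast
    next
      case False
      from decide_two_branches[OF h(1,2), of t] obtain k l where kl: "k \<noteq> 0" "l \<noteq> 0"
        "\<forall>x y. truncate p a k \<sqsubseteq> x \<longrightarrow> truncate q b l \<sqsubseteq> y \<longrightarrow> (less_fun p x, less_fun q y) = t"
        by (elim exE conjE) (rule that)
      let ?\<tau> = "\<sigma>(m := truncate p a k, n := truncate q b l)"
      have "truncate p a k \<in> T" "truncate q b l \<in> T"
        using T_truncate \<open>p \<in> T\<close> \<open>q \<in> T\<close> h(1,2) kl(1,2) unfolding height_def by blast+
      then have "?\<tau> \<in> ?S"
        using that by simp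
      moreover have "?\<tau> \<in> G (m, n, t)"
        using kl(3) False by (intro G_I[OF pq(1)]) simp
      moreover have "\<sigma> m \<sqsubseteq> truncate p a k" "\<sigma> n \<sqsubseteq> truncate q b l"
        using pq(2,3) h(1,2) end_extends_truncate end_extends_trans by blast+
      then have "R \<sigma> ?\<tau>"
        by (simp add: R_def end_extends_refl)
      ultimately show ?thesis
        by blast
    qed
  qed
  have "R \<sigma> \<sigma>" for \<sigma>
    by (simp add: R_def end_extends_refl)
  moreover have "R \<rho> \<tau>" if "R \<rho> \<sigma>" "R \<sigma> \<tau>" for \<rho> \<sigma> \<tau>
    using that unfolding R_def by (meson end_extends_trans)
  moreover have "countable (H ` (UNIV \<times> {..<d}) \<union> range G)"
    using seg by auto
  moreover have "\<exists>\<tau>\<in>?S \<inter> D. R \<sigma> \<tau>" 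
    if D: "D \<in> H ` (UNIV \<times> {..<d}) \<union> range G" and \<sigma>: "\<sigma> \<in> ?S" for D \<sigma>
  proof (cases "D \<in> range G")
    case True
    then obtain m n t where "D = G (m, n, t)"
      by auto
    then show ?thesis
      using G_dense[OF \<sigma>] by simp
  next
    case False
    then obtain n a where "D = H (n, a)" "a < d"
      using D by auto
    then show ?thesis
      using H_dense[OF _ \<sigma>] by simp
  qed
  \<comment> \<open>Starting from an enumeration of \<open>T\<close> puts a branch above every node
    of \<open>T\<close>.\<close>
  moreover have "from_nat_into T \<in> ?S"
    using \<open>T \<noteq> {}\<close> by (simp add: from_nat_into)
  ultimately have "\<exists>\<sigma> :: nat \<Rightarrow> nat \<Rightarrow> 'a \<Rightarrow> rat. \<sigma> 0 = from_nat_into T \<and> (\<forall>i. \<sigma> i \<in> ?S) \<and>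
      (\<forall>i j. i \<le> j \<longrightarrow> R (\<sigma> i) (\<sigma> j)) \<and>
      (\<forall>D\<in>H ` (UNIV \<times> {..<d}) \<union> range G. \<exists>i. \<sigma> i \<in> D)"
    by (rule generic_chain)
  then obtain \<sigma> :: "nat \<Rightarrow> nat \<Rightarrow> 'a \<Rightarrow> rat" where \<sigma>: "\<sigma> 0 = from_nat_into T"
    "\<forall>i. \<sigma> i \<in> ?S" "\<forall>i j. i \<le> j \<longrightarrow> R (\<sigma> i) (\<sigma> j)"
    "\<forall>D\<in>H ` (UNIV \<times> {..<d}) \<union> range G. \<exists>i. \<sigma> i \<in> D"
    by (elim exE conjE) (rule that)
  have "\<exists>x. (\<forall>i. \<sigma> i n \<sqsubseteq> x) \<and> (\<forall>a. x a \<noteq> 0 \<longrightarrow> (\<exists>i. \<sigma> i n a \<noteq> 0))" for n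
  proof (rule end_extends_chain_limit[of "\<lambda>i. \<sigma> i n"])
    show "\<sigma> i n \<sqsubseteq> \<sigma> j n" if "i \<le> j" for i j
      using \<sigma>(3) that by (simp add: R_def)
  qed blast
  then obtain v where v: "\<And>i n. \<sigma> i n \<sqsubseteq> v n" "\<And>n a. v n a \<noteq> 0 \<Longrightarrow> \<exists>i. \<sigma> i n a \<noteq> 0"
    by metis
  have reach: "\<exists>i. \<sigma> i n a \<noteq> 0" if "a < d" for n a
  proof -
    have "\<exists>i. \<sigma> i \<in> H (n, a)"
      using \<sigma>(4) that by blast
    then show ?thesis
      by (simp add: H_def)
  qed
  show ?thesis
  proof (intro exI[of _ v] conjI allI impI ballI)
    show "height (v n) d" for n
      unfolding height_def
    proof (intro allI iffI)
      fix a assume "v n a \<noteq> 0"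
      with v(2) obtain i where "\<sigma> i n a \<noteq> 0"
        by blast
      moreover from \<sigma>(2) T_height obtain b where "b < d" "height (\<sigma> i n) b"
        by blast
      ultimately show "a < d"
        unfolding height_def using less_trans by blast
    next
      fix a assume "a < d"
      with reach obtain i where "\<sigma> i n a \<noteq> 0"
        by blast
      with v(1)[of i n] show "v n a \<noteq> 0"
        by (auto simp: end_extends_def)
    qed
    show "\<exists>s\<in>T. s \<sqsubseteq> v n \<and> s a \<noteq> 0" if "a < d" for n a
      using reach[OF that] \<sigma>(2) v(1) by blast
    show "\<exists>n. s \<sqsubseteq> v n" if "s \<in> T" for s
      using from_nat_into_surj[OF \<open>countable T\<close> that] \<sigma>(1) v(1)[of 0] by metis
    show "sealed A T (v m) (v n) t" for m n t
    proof -
      obtain i where "\<sigma> i \<in> G (m, n, t)"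
        using \<sigma>(4) by blast
      then consider
          (avoid) "\<not> (\<exists>p q. (p, q) \<in> A \<and> \<sigma> i m \<sqsubseteq> p \<and> \<sigma> i n \<sqsubseteq> q)"
        | (meet) p q where "(p, q) \<in> A" "\<forall>x y. \<sigma> i m \<sqsubseteq> x \<longrightarrow> \<sigma> i n \<sqsubseteq> y \<longrightarrow>
            (less_fun p x, less_fun q y) \<in> {t, neg_type t}"
        unfolding G_def prod.case mem_Collect_eq by (elim disjE exE conjE) simp_all
      then show ?thesis
      proof cases
        case avoid
        then show ?thesis
          unfolding sealed_def using \<sigma>(2) v(1)
          by (intro disjI1 bexI[of _ "\<sigma> i m"] bexI[of _ "\<sigma> i n"]) simp_all
      next
        case meet
        have "\<sigma> i j \<sqsubseteq> x" if "v j \<sqsubseteq> x" for j x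
          using v(1) that by (rule end_extends_trans)
        with meet show ?thesis
          unfolding sealed_def by (intro disjI2 exI[of _ p] exI[of _ q]) simp
      qed
    qed
  qed
qed

subsection \<open>The tree\<close>

definition nodes_below :: "('a::linorder \<Rightarrow> nat \<Rightarrow> 'a \<Rightarrow> rat) \<Rightarrow> 'a \<Rightarrow> ('a \<Rightarrow> rat) set" where
  "nodes_below f d = {f a i | a i. a < d}"

text \<open>A name \<open>(a, i)\<close> stands for the \<open>i\<close>-th node \<open>f a i\<close> of level \<open>a\<close>; enumerations may repeat nodes.\<close>

definition decode :: "('a \<Rightarrow> (('a \<times> nat) \<times> ('a \<times> nat)) set) \<Rightarrow> ('a::linorder \<Rightarrow> nat \<Rightarrow> 'a \<Rightarrow> rat) \<Rightarrow>
    'a \<Rightarrow> (('a \<Rightarrow> rat) \<times> ('a \<Rightarrow> rat)) set" where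
  "decode B f d =
    {(f a i, f b j) | a i b j. ((a, i), (b, j)) \<in> B d \<and> a < d \<and> b < d \<and> f a i \<noteq> f b j}"

text \<open>The condition \<open>\<forall>b<d. b \<le> a\<close> makes \<open>d\<close> the
  successor of \<open>a\<close>, and the premise of the last clause makes \<open>d\<close> a nonzero
  limit. Only the levels of \<open>f\<close> below \<open>d\<close> are mentioned, as a recursive
  construction requires.\<close>

definition tree_level :: "('a \<Rightarrow> (('a \<times> nat) \<times> ('a \<times> nat)) set) \<Rightarrow>
    ('a::wellorder \<Rightarrow> nat \<Rightarrow> 'a \<Rightarrow> rat) \<Rightarrow> 'a \<Rightarrow> (nat \<Rightarrow> 'a \<Rightarrow> rat) \<Rightarrow> bool" where
  "tree_level B f d v \<longleftrightarrow>
    (\<forall>n. height (v n) d) \<and>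
    (\<forall>a<d. \<forall>n. \<exists>m. f a m \<sqsubseteq> v n) \<and>
    (\<forall>a<d. \<forall>m. \<exists>n. f a m \<sqsubseteq> v n) \<and>
    (\<forall>a<d. (\<forall>b<d. b \<le> a) \<longrightarrow> (\<forall>m k. k \<noteq> 0 \<longrightarrow> (\<exists>n. v n = truncate (f a m) a k))) \<and>
    ((\<exists>a. a < d) \<and> (\<forall>a<d. \<exists>b<d. a < b) \<longrightarrow>
      (\<forall>m n t. sealed (decode B f d) (nodes_below f d) (v m) (v n) t))"

lemma tree_level_cong:
  assumes "\<And>a. a < d \<Longrightarrow> f a = g a"
  shows "tree_level B f d v \<longleftrightarrow> tree_level B g d v"
proof -
  have "nodes_below f d = nodes_below g d"
    unfolding nodes_below_def using assms by (metis (no_types, opaque_lifting))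
  moreover have "decode B f d = decode B g d"
    unfolding decode_def using assms by (metis (no_types, opaque_lifting))
  ultimately show ?thesis
    unfolding tree_level_def using assms by simp
qed

lemma tree_level_down:
  assumes "tree_level B f b (f b)" "a \<le> b"
  shows "\<exists>m. f a m \<sqsubseteq> f b n"
  using assms end_extends_refl unfolding tree_level_def by (metis order_le_less)

lemma tree_level_up:
  assumes "tree_level B f b (f b)" "a \<le> b"
  shows "\<exists>n. f a m \<sqsubseteq> f b n"
  using assms end_extends_refl unfolding tree_level_def by (metis order_le_less)

lemma tree_levelI:
  assumes "\<And>n. height (v n) d" "\<And>a n. a < d \<Longrightarrow> \<exists>m. f a m \<sqsubseteq> v n"
    "\<And>a m. a < d \<Longrightarrow> \<exists>n. f a m \<sqsubseteq> v n"
    "\<And>a m k. a < d \<Longrightarrow> \<forall>b<d. b \<le> a \<Longrightarrow> k \<noteq> 0 \<Longrightarrow> \<exists>n. v n = truncate (f a m) a k"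
    "\<And>m n t. \<exists>a. a < d \<Longrightarrow> \<forall>a<d. \<exists>b<d. a < b \<Longrightarrow>
      sealed (decode B f d) (nodes_below f d) (v m) (v n) t"
  shows "tree_level B f d v"
  unfolding tree_level_def using assms by simp

text \<open>Level zero consists of the empty function. A successor level adds every nonzero rational
  as a last value to every node. At a limit, \<open>generic_branches\<close> is applied to the tree
  built so far and to the decoded guess.\<close>

lemma tree_level_step:
  fixes d :: "'a::wellorder"
  assumes seg: "countable {..<d}" and IH: "\<And>a. a < d \<Longrightarrow> tree_level B f a (f a)"
  shows "\<exists>v. tree_level B f d v"
proof -
  have f_height: "height (f a n) a" if "a < d" for a n
    using IH[OF that] by (simp add: tree_level_def)
  have f_down: "\<exists>m. f a m \<sqsubseteq> f b n" if "a \<le> b" "b < d" for a b n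
    using IH[OF that(2)] that(1) by (rule tree_level_down)
  have f_up: "\<exists>n. f a m \<sqsubseteq> f b n" if "a \<le> b" "b < d" for a b m
    using IH[OF that(2)] that(1) by (rule tree_level_up)
  consider (zero) "\<not> (\<exists>a. a < d)" | (succ) c where "c < d" "\<And>b. b < d \<Longrightarrow> b \<le> c"
    | (limit) "\<exists>a. a < d" "\<And>a. a < d \<Longrightarrow> \<exists>b<d. a < b"
    by (meson not_less)
  then show ?thesis
  proof cases
    case zero
    then have "tree_level B f d (\<lambda>_ _. 0)"
      by (auto simp: tree_level_def height_def)
    then show ?thesis
      by blast
  next
    case succ
    \<comment> \<open>The enumeration of pairs also yields \<open>k = 0\<close>, which would add no
      value and miss height \<open>d\<close>; it is replaced by 1.\<close>
    define v where "v n = (let (m, k) = from_nat n in truncate (f c m) c (if k = 0 then 1 else k))"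
      for n
    have v_eq: "\<exists>n. v n = truncate (f c m) c k" if "k \<noteq> 0" for m k
      using that by (intro exI[of _ "to_nat (m, k)"]) (simp add: v_def)
    have v_cases: "\<exists>m k. k \<noteq> 0 \<and> v n = truncate (f c m) c k" for n
    proof -
      obtain m k where "from_nat n = (m :: nat, k :: rat)"
        by fastforce
      then show ?thesis
        by (intro exI[of _ m] exI[of _ "if k = 0 then 1 else k"] conjI) (simp_all add: v_def)
    qed
    have less_d: "b < d \<longleftrightarrow> b < c \<or> b = c" for b
      using succ(1) succ(2)[of b] by auto
    have "tree_level B f d v"
    proof (rule tree_levelI)
      fix n
      obtain m k where mk: "k \<noteq> 0" "v n = truncate (f c m) c k"
        using v_cases by blast
      show "height (v n) d"
        using f_height[OF succ(1), of m] unfolding mk(2) height_def truncate_def less_d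
        by (auto simp: mk(1))
      show "\<exists>m. f a m \<sqsubseteq> v n" if "a < d" for a
        using f_down[OF succ(2)[OF that] succ(1)] mk(2)
          end_extends_truncate[OF f_height[OF succ(1)]] end_extends_trans by metis
    next
      fix a m assume "a < d"
      with f_up[OF succ(2) succ(1)] obtain i where "f a m \<sqsubseteq> f c i"
        by blast
      moreover obtain n where "v n = truncate (f c i) c 1"
        using v_eq[of 1 i] by auto
      ultimately show "\<exists>n. f a m \<sqsubseteq> v n"
        using end_extends_truncate[OF f_height[OF succ(1)]] end_extends_trans by metis
    next
      fix a m k assume "a < d" "\<forall>b<d. b \<le> a" "(k::rat) \<noteq> 0"
      moreover from this have "a = c"
        using succ by (simp add: order_antisym)
      ultimately show "\<exists>n. v n = truncate (f a m) a k"
        using v_eq by simp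
    next
      assume "\<forall>a<d. \<exists>b<d. a < b"
      with succ show "sealed (decode B f d) (nodes_below f d) (v m) (v n) t" for m n t
        by (meson not_less)
    qed
    then show ?thesis
      by blast
  next
    case limit
    let ?T = "nodes_below f d"
    have "?T = (\<lambda>(a, i). f a i) ` ({..<d} \<times> UNIV)"
      by (auto simp: nodes_below_def)
    then have "countable ?T" "?T \<noteq> {}"
      using seg limit(1) by auto
    moreover have "\<exists>a<d. height s a" if "s \<in> ?T" for s
      using that f_height by (auto simp: nodes_below_def)
    \<comment> \<open>The truncation depends only on the node \<open>f a m\<close> below
      \<open>s\<close> at level \<open>a\<close>. It therefore occurs at the successor
      \<open>c\<close> of \<open>a\<close>, which is below \<open>d\<close> because \<open>d\<close>
      is a limit.\<close>
    moreover have "truncate s a k \<in> ?T"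
      if s: "s \<in> ?T" "\<And>b. b < a \<Longrightarrow> s b \<noteq> 0" and "k \<noteq> 0" for s a k
    proof -
      from s(1) obtain b i where b: "s = f b i" "b < d"
        by (auto simp: nodes_below_def)
      have "a \<le> b"
        using s(2)[of b] f_height[OF b(2), of i] by (auto simp: b(1) height_def not_less[symmetric])
      with b obtain m where m: "f a m \<sqsubseteq> s"
        using f_down by blast
      have "a < d"
        using \<open>a \<le> b\<close> \<open>b < d\<close> by simp
      have "truncate s a k = truncate (f a m) a k"
        using m f_height[OF \<open>a < d\<close>, of m] by (auto simp: truncate_def end_extends_def height_def)
      moreover define c where "c = (LEAST c. a < c)"
      obtain c' where "a < c'" "c' < d"
        using limit(2)[OF \<open>a < d\<close>] by blast
      then have "a < c" "c < d"
        unfolding c_def by (auto intro: LeastI le_less_trans[OF Least_le])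
      moreover have "\<forall>b<c. b \<le> a"
        unfolding c_def by (auto dest: not_less_Least)
      ultimately obtain n where "f c n = truncate s a k"
        using IH[OF \<open>c < d\<close>] \<open>k \<noteq> 0\<close> unfolding tree_level_def by metis
      then have "truncate s a k = f c n"
        by simp
      with \<open>c < d\<close> show ?thesis
        unfolding nodes_below_def by blast
    qed
    moreover have "\<exists>s'\<in>?T. s \<sqsubseteq> s' \<and> s' a \<noteq> 0" if "s \<in> ?T" "a < d" for s a
    proof -
      from that(1) obtain b i where b: "s = f b i" "b < d"
        by (auto simp: nodes_below_def)
      from limit(2)[OF that(2)] obtain c where "c < d" "a < c"
        by blast
      with b have "max b c < d" "b \<le> max b c" "a < max b c"
        by (auto simp: max_def)
      moreover from this obtain n where "f b i \<sqsubseteq> f (max b c) n"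
        using f_up by blast
      ultimately show ?thesis
        using f_height[of "max b c" n] unfolding b nodes_below_def height_def by blast
    qed
    moreover have "p \<in> ?T \<and> q \<in> ?T \<and> p \<noteq> q" if "(p, q) \<in> decode B f d" for p q
      using that by (auto simp: decode_def nodes_below_def)
    ultimately have "\<exists>v :: nat \<Rightarrow> 'a \<Rightarrow> rat. (\<forall>n. height (v n) d) \<and>
        (\<forall>n. \<forall>a<d. \<exists>s\<in>?T. s \<sqsubseteq> v n \<and> s a \<noteq> 0) \<and> (\<forall>s\<in>?T. \<exists>n. s \<sqsubseteq> v n) \<and>
        (\<forall>m n t. sealed (decode B f d) ?T (v m) (v n) t)"
      by (rule generic_branches[OF seg])
    then obtain v :: "nat \<Rightarrow> 'a \<Rightarrow> rat" where v: "\<forall>n. height (v n) d"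
      "\<forall>n. \<forall>a<d. \<exists>s\<in>?T. s \<sqsubseteq> v n \<and> s a \<noteq> 0" "\<forall>s\<in>?T. \<exists>n. s \<sqsubseteq> v n"
      "\<forall>m n t. sealed (decode B f d) ?T (v m) (v n) t"
      by blast
    \<comment> \<open>A node below \<open>v n\<close> that is nonzero at \<open>a\<close> has level
      above \<open>a\<close>, and its predecessor at level \<open>a\<close> is the one
      sought.\<close>
    have "\<exists>m. f a m \<sqsubseteq> v n" if "a < d" for a n
    proof -
      from v(2) \<open>a < d\<close> obtain s where s: "s \<in> ?T" "s \<sqsubseteq> v n" "s a \<noteq> 0"
        by blast
      then obtain b i where b: "b < d" "f b i \<sqsubseteq> v n" "f b i a \<noteq> 0"
        by (auto simp: nodes_below_def)
      then have "a < b"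
        using f_height[of b i] by (auto simp: height_def)
      then show ?thesis
        using f_down[of a b i] b end_extends_trans by (metis order_less_imp_le)
    qed
    moreover have "\<exists>n. f a m \<sqsubseteq> v n" if "a < d" for a m
      using v(3) that unfolding nodes_below_def by blast
    moreover have "\<exists>n. v n = truncate (f a m) a k" if "a < d" "\<forall>b<d. b \<le> a" for a m k
      using limit(2)[OF that(1)] that(2) by (meson not_le)
    ultimately have "tree_level B f d v"
      using v(1,4) by (intro tree_levelI) (simp_all del: split_paired_All)
    then show ?thesis
      by blast
  qed
qed

lemma tree_exists:
  fixes B :: "'a::wellorder \<Rightarrow> (('a \<times> nat) \<times> ('a \<times> nat)) set"
  assumes "\<And>d::'a. countable {..<d}"
  shows "\<exists>f. \<forall>d. tree_level B f d (f d)"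
proof (rule dependent_wf_choice[where R = "{(a, b). a < b}"])
  show "wf {(a::'a, b). a < b}"
    by (rule wf)
  show "tree_level B f d v = tree_level B g d v"
    if "\<And>a. (a, d) \<in> {(a, b). a < b} \<Longrightarrow> f a = g a" for f g d v
    using that by (intro tree_level_cong) simp
  show "\<exists>v. tree_level B f d v"
    if "\<And>a. (a, d) \<in> {(a, b). a < b} \<Longrightarrow> tree_level B f a (f a)" for d f
    using that by (intro tree_level_step assms) simp
qed

subsection \<open>The line\<close>

text \<open>Through \<open>code\<close>, the pairs of names of members of \<open>F\<close> form a
  set of ordinals, which \<open>A\<close> guesses at a closure point \<open>d\<close>. The sealing
  of level \<open>d\<close> then governs every member of \<open>F\<close> with both entries at or
  above \<open>d\<close>.\<close>

lemma entangled_of_tree: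
  fixes f :: "om1 \<Rightarrow> nat \<Rightarrow> om1 \<Rightarrow> rat" and code :: "(om1 \<times> nat) \<times> (om1 \<times> nat) \<Rightarrow> om1"
  assumes A: "\<And>X H. \<forall>b. countable (H b) \<Longrightarrow>
      \<exists>d. (\<exists>b. b < d) \<and> (\<forall>b<d. H b \<subseteq> {..<d}) \<and> X \<inter> {..<d} = A d \<inter> {..<d}"
    and code: "inj code"
    and f: "\<And>d. tree_level (\<lambda>d. code -` A d) f d (f d)"
    and F: "F \<subseteq> range (case_prod f) \<times> range (case_prod f)" "uncountable F"
    and F_one_one: "\<And>x y. (x, y) \<in> F \<Longrightarrow> x \<noteq> y"
    and F_disjoint: "inj_on fst F" "inj_on snd F"
  shows "\<exists>x y p q. (x, y) \<in> F \<and> (p, q) \<in> F \<and> x \<noteq> p \<and> (less_fun p x, less_fun q y) \<in> {t, neg_type t}"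
proof -
  let ?node = "case_prod f"
  \<comment> \<open>\<open>W s s' z\<close> says that \<open>z\<close> names a member of
    \<open>F\<close> above the nodes named \<open>s\<close> and \<open>s'\<close>; \<open>w\<close>
    fixes one such \<open>z\<close> whenever there is one.\<close>
  define W where "W s s' z \<longleftrightarrow> (?node (fst z), ?node (snd z)) \<in> F \<and>
      ?node s \<sqsubseteq> ?node (fst z) \<and> ?node s' \<sqsubseteq> ?node (snd z)" for s s' z
  define w where "w s s' = (SOME z. W s s' z)" for s s'
  have w: "W s s' (w s s')" if "W s s' z" for s s' z
    unfolding w_def using that by (rule someI)
  define N :: "om1 \<Rightarrow> (om1 \<times> nat) set" where "N b = {..b} \<times> UNIV" for b
  \<comment> \<open>The ordinal \<open>succ_om1 b\<close> makes \<open>d\<close> a limit, the codes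
    let the guess decide membership in \<open>F\<close> for names below \<open>d\<close>, and the
    last two entries keep the levels of the chosen witnesses below \<open>d\<close>.\<close>
  define H where "H b = insert (succ_om1 b) (\<Union>(s, s')\<in>N b \<times> N b.
      {code (s, s'), fst (fst (w s s')), fst (snd (w s s'))})" for b
  have "countable (N b)" for b
    using countable_atMost_om1 by (simp add: N_def)
  then have "\<forall>b. countable (H b)"
    unfolding H_def by (auto intro!: countable_UN)
  from A[OF this, of "code ` {z. (?node (fst z), ?node (snd z)) \<in> F}"]
  obtain d where d: "\<exists>b. b < d" "\<forall>b<d. H b \<subseteq> {..<d}"
    "code ` {z. (?node (fst z), ?node (snd z)) \<in> F} \<inter> {..<d} = A d \<inter> {..<d}"
    by blast
  have closed: "code (s, s') < d" "fst (fst (w s s')) < d" "fst (snd (w s s')) < d"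
    if "fst s < d" "fst s' < d" for s s'
  proof -
    let ?b = "max (fst s) (fst s')"
    have "s \<in> N ?b" "s' \<in> N ?b"
      by (auto simp: N_def mem_Times_iff)
    then have "{code (s, s'), fst (fst (w s s')), fst (snd (w s s'))} \<subseteq> H ?b"
      unfolding H_def by blast
    also have "H ?b \<subseteq> {..<d}"
      using d(2) that by simp
    finally show "code (s, s') < d" "fst (fst (w s s')) < d" "fst (snd (w s s')) < d"
      by auto
  qed
  have limit: "\<exists>c<d. b < c" if "b < d" for b
    using d(2) that less_succ_om1_iff[of b b] unfolding H_def by blast
  have code_iff: "code (s, s') \<in> A d \<longleftrightarrow> (?node s, ?node s') \<in> F"
    if "fst s < d" "fst s' < d" for s s'
  proof -
    have "code (s, s') \<in> A d \<longleftrightarrow> code (s, s') \<in> code ` {z. (?node (fst z), ?node (snd z)) \<in> F}"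
      using d(3) closed(1)[OF that] by blast
    also have "\<dots> \<longleftrightarrow> (?node s, ?node s') \<in> F"
      by (simp add: inj_image_mem_iff[OF code])
    finally show ?thesis .
  qed
  let ?T = "nodes_below f d"
  \<comment> \<open>A correct guess decodes to exactly the part of \<open>F\<close> whose entries
    have height below \<open>d\<close>.\<close>
  have decode: "decode (\<lambda>d. code -` A d) f d = F \<inter> ?T \<times> ?T"
  proof (intro equalityI subrelI)
    fix p q assume "(p, q) \<in> decode (\<lambda>d. code -` A d) f d"
    then obtain a i b j where "p = f a i" "q = f b j" "code ((a, i), (b, j)) \<in> A d" "a < d" "b < d"
      unfolding decode_def by auto
    then show "(p, q) \<in> F \<inter> ?T \<times> ?T"
      using code_iff[of "(a, i)" "(b, j)"] unfolding nodes_below_def by auto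
  next
    fix p q assume pq: "(p, q) \<in> F \<inter> ?T \<times> ?T"
    then obtain a i b j where ab: "p = f a i" "q = f b j" "a < d" "b < d"
      unfolding nodes_below_def by auto
    with pq have "code ((a, i), (b, j)) \<in> A d" "f a i \<noteq> f b j"
      using code_iff[of "(a, i)" "(b, j)"] F_one_one by auto
    with ab show "(p, q) \<in> decode (\<lambda>d. code -` A d) f d"
      unfolding decode_def by blast
  qed
  have "?T = case_prod f ` ({..<d} \<times> UNIV)"
    by (auto simp: nodes_below_def)
  then have "countable ?T"
    using countable_lessThan_om1 by simp
  \<comment> \<open>By disjointness each of the countably many nodes below \<open>d\<close> occurs
    at most once in each coordinate. Hence all but countably many pairs in \<open>F\<close> have
    both entries at or above \<open>d\<close>.\<close>
  have "countable {e \<in> F. g e \<in> ?T}" if "inj_on g F" for g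
  proof (rule countable_image_inj_on)
    show "countable (g ` {e \<in> F. g e \<in> ?T})"
      by (rule countable_subset[OF _ \<open>countable ?T\<close>]) auto
    show "inj_on g {e \<in> F. g e \<in> ?T}"
      using that by (rule inj_on_subset) auto
  qed
  from this[OF F_disjoint(1)] this[OF F_disjoint(2)]
  have "countable ({e \<in> F. fst e \<in> ?T} \<union> {e \<in> F. snd e \<in> ?T})"
    by (rule countable_Un)
  then obtain e where "e \<in> F" "fst e \<notin> ?T" "snd e \<notin> ?T"
    using F(2) countable_subset[of F "{e \<in> F. fst e \<in> ?T} \<union> {e \<in> F. snd e \<in> ?T}"] by blast
  then obtain x y where xy: "(x, y) \<in> F" "x \<notin> ?T" "y \<notin> ?T"
    by (cases e) auto
  have above: "\<exists>m. f d m \<sqsubseteq> z" if z: "z \<in> range ?node" "z \<notin> ?T" for z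
  proof -
    obtain a i where ai: "z = f a i"
      using z(1) by auto
    with z(2) have "d \<le> a"
      unfolding nodes_below_def by (auto simp: not_less[symmetric])
    then show ?thesis
      unfolding ai by (rule tree_level_down[OF f])
  qed
  obtain m n where mn: "f d m \<sqsubseteq> x" "f d n \<sqsubseteq> y"
    using above[of x] above[of y] xy F(1) by blast
  have "sealed (F \<inter> ?T \<times> ?T) ?T (f d m) (f d n) t"
    using f[of d] d(1) limit unfolding tree_level_def decode by blast
  then consider
      (avoid) s s' where "s \<in> ?T" "s' \<in> ?T" "s \<sqsubseteq> f d m" "s' \<sqsubseteq> f d n"
        "\<not> (\<exists>p q. (p, q) \<in> F \<inter> ?T \<times> ?T \<and> s \<sqsubseteq> p \<and> s' \<sqsubseteq> q)"
    | (meet) p q where "(p, q) \<in> F \<inter> ?T \<times> ?T" "\<forall>x y. f d m \<sqsubseteq> x \<longrightarrow> f d n \<sqsubseteq> y \<longrightarrow>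
        (less_fun p x, less_fun q y) \<in> {t, neg_type t}"
    unfolding sealed_def by blast
  then show ?thesis
  proof cases
    \<comment> \<open>The pair \<open>(x, y)\<close> shows that \<open>F\<close> has a member above
      \<open>s\<close> and \<open>s'\<close>. The witness chosen by \<open>w\<close> is then such a
      member with entries below \<open>d\<close>, against the avoidance.\<close>
    case avoid
    then obtain a i b j where ab: "s = f a i" "s' = f b j" "a < d" "b < d"
      unfolding nodes_below_def by blast
    obtain z z' where z: "x = ?node z" "y = ?node z'"
      using xy(1) F(1) by blast
    have "s \<sqsubseteq> x" "s' \<sqsubseteq> y"
      using avoid(3,4) mn end_extends_trans by blast+
    then have "W (a, i) (b, j) (z, z')"
      using xy(1) ab z unfolding W_def by simp
    then have W: "W (a, i) (b, j) (w (a, i) (b, j))"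
      by (rule w)
    obtain p q where pq: "w (a, i) (b, j) = (p, q)"
      by (cases "w (a, i) (b, j)")
    have "?node p \<in> ?T" "?node q \<in> ?T"
      using closed(2,3)[of "(a, i)" "(b, j)"] ab pq unfolding nodes_below_def
      by (auto simp: case_prod_beta)
    then have False
      using avoid(5) W unfolding W_def pq ab by auto
    then show ?thesis ..
  next
    case meet
    then have "x \<noteq> p"
      using xy by auto
    with meet mn xy show ?thesis
      by blast
  qed
qed

text \<open>Take a node whose height \<open>d\<close> exceeds all heights in \<open>D\<close>, and
  extend it by the values 1, 2 and 3. By convexity everything between the outer two extends that
  node, hence is too high to lie in \<open>D\<close>.\<close>

lemma gap_of_tree:
  fixes f :: "om1 \<Rightarrow> nat \<Rightarrow> om1 \<Rightarrow> rat"
  assumes f: "\<And>d. tree_level B f d (f d)"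
    and D: "countable D" "D \<subseteq> range (case_prod f)"
  shows "\<exists>x\<in>range (case_prod f). \<exists>y\<in>range (case_prod f). \<exists>z\<in>range (case_prod f).
    less_fun x y \<and> less_fun y z \<and> (\<forall>u\<in>D. \<not> (less_fun x u \<and> less_fun u z))"
proof -
  have f_height: "height (f a n) a" for a n
    using f[of a] by (simp add: tree_level_def)
  from D(2) have "\<forall>u\<in>D. \<exists>a. height u a"
    using f_height by fastforce
  then obtain h where h: "\<And>u. u \<in> D \<Longrightarrow> height u (h u)"
    by metis
  have "countable (h ` D)"
    using D(1) by simp
  then obtain d where d: "\<forall>a\<in>h ` D. a < d"
    using countable_bounded_om1 by blast
  let ?s = "f d 0"
  have succ: "\<exists>n. f (succ_om1 d) n = truncate ?s d k" if "k \<noteq> 0" for k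
    using f[of "succ_om1 d"] that unfolding tree_level_def less_succ_om1_iff by blast
  have in_range: "truncate ?s d k \<in> range (case_prod f)" if k: "k \<noteq> 0" for k
  proof -
    obtain n where "f (succ_om1 d) n = truncate ?s d k"
      using succ[OF k] by blast
    then have "truncate ?s d k = case_prod f (succ_om1 d, n)"
      by simp
    then show ?thesis
      by blast
  qed
  have less: "less_fun (truncate ?s d k) (truncate ?s d l)" if "k < l" for k l
    using that by (auto simp: less_fun_def truncate_def intro!: exI[of _ d])
  have ext: "?s \<sqsubseteq> truncate ?s d k" for k
    by (rule end_extends_truncate[OF f_height])
  have "\<not> (less_fun (truncate ?s d 1) u \<and> less_fun u (truncate ?s d 3))" if "u \<in> D" for u
  proof
    assume "less_fun (truncate ?s d 1) u \<and> less_fun u (truncate ?s d 3)"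
    then have "?s \<sqsubseteq> u"
      using less_fun_convex[OF f_height ext ext] by blast
    have "h u < d"
      using d that by blast
    then have "?s (h u) \<noteq> 0"
      using f_height[of d 0] by (simp add: height_def)
    with \<open>?s \<sqsubseteq> u\<close> have "u (h u) \<noteq> 0"
      by (simp add: end_extends_def)
    then show False
      using h[OF that] by (simp add: height_def)
  qed
  moreover have "less_fun (truncate ?s d 1) (truncate ?s d 2)"
    "less_fun (truncate ?s d 2) (truncate ?s d 3)"
    by (simp_all add: less)
  moreover have "truncate ?s d 1 \<in> range (case_prod f)" "truncate ?s d 2 \<in> range (case_prod f)"
    "truncate ?s d 3 \<in> range (case_prod f)"
    by (simp_all add: in_range del: image_iff)
  ultimately show ?thesis
    by meson
qed

section \<open>Transfer of the lexicographic order to a relation along an injection\<close>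

definition lex_image :: "(('a::wellorder \<Rightarrow> rat) \<Rightarrow> 'b) \<Rightarrow> ('a \<Rightarrow> rat) set \<Rightarrow> 'b rel" where
  "lex_image g E = {(g x, g y) | x y. x \<in> E \<and> y \<in> E \<and> (x = y \<or> less_fun x y)}"

lemma lex_image_iff:
  assumes "inj_on g E" "x \<in> E" "y \<in> E"
  shows "(g x, g y) \<in> lex_image g E \<longleftrightarrow> x = y \<or> less_fun x y"
  using assms unfolding lex_image_def by (auto dest: inj_onD)

lemma Field_lex_image: "Field (lex_image g E) = g ` E"
  unfolding lex_image_def Field_def by blast

lemma strictly_below_lex_image:
  assumes "inj_on g E" "x \<in> E" "y \<in> E"
  shows "strictly_below (lex_image g E) (g x) (g y) \<longleftrightarrow> less_fun x y"
  using assms less_fun_irrefl[of x] inj_on_eq_iff[OF assms]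
  unfolding strictly_below_def lex_image_iff[OF assms] by auto

lemma Linear_order_lex_image:
  assumes g: "inj_on g E"
  shows "Linear_order (lex_image g E)"
proof -
  let ?r = "lex_image g E"
  have "refl_on (g ` E) ?r"
    by (auto simp: refl_on_def lex_image_iff[OF g])
  moreover have "?r \<subseteq> g ` E \<times> g ` E"
    unfolding lex_image_def by blast
  moreover have "trans ?r"
  proof (rule transI)
    fix a b c assume ab: "(a, b) \<in> ?r" and bc: "(b, c) \<in> ?r"
    from ab obtain x y where "a = g x" "b = g y" "x \<in> E" "y \<in> E"
      unfolding lex_image_def by blast
    moreover from bc obtain z where "c = g z" "z \<in> E"
      unfolding lex_image_def by blast
    ultimately show "(a, c) \<in> ?r"
      using less_fun_trans[of x y z] ab bc by (auto simp: lex_image_iff[OF g])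
  qed
  moreover have "antisym ?r"
  proof (rule antisymI)
    fix a b assume ab: "(a, b) \<in> ?r" "(b, a) \<in> ?r"
    from ab(1) obtain x y where "a = g x" "b = g y" "x \<in> E" "y \<in> E"
      unfolding lex_image_def by blast
    with ab show "a = b"
      using less_fun_asym[of x y] by (auto simp: lex_image_iff[OF g])
  qed
  moreover have "total_on (g ` E) ?r"
    unfolding total_on_def by (auto simp: lex_image_iff[OF g] dest!: less_fun_total)
  ultimately show ?thesis
    by (simp add: order_on_defs Field_lex_image)
qed

text \<open>A countable dense set is pulled back along \<open>g\<close>; the hypothesis then
  supplies an interval, nonempty because of \<open>y\<close>, that it misses.\<close>

lemma not_separable_lex_image:
  assumes g: "inj_on g E"
    and gap: "\<And>D. countable D \<Longrightarrow> D \<subseteq> E \<Longrightarrow>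
      \<exists>x\<in>E. \<exists>y\<in>E. \<exists>z\<in>E. less_fun x y \<and> less_fun y z \<and> (\<forall>u\<in>D. \<not> (less_fun x u \<and> less_fun u z))"
  shows "\<not> separable_order (lex_image g E)"
proof
  let ?r = "lex_image g E"
  assume "separable_order ?r"
  then obtain D' where D': "D' \<subseteq> g ` E" "countable D'"
    "\<forall>I\<in>open_intervals ?r. I \<noteq> {} \<longrightarrow> D' \<inter> I \<noteq> {}"
    unfolding separable_order_def Field_lex_image by blast
  from D'(1) obtain D where D: "D \<subseteq> E" "D' = g ` D"
    unfolding subset_image_iff by blast
  have "countable D"
    using D'(2) inj_on_subset[OF g D(1)] unfolding D(2) by (rule countable_image_inj_on)
  from gap[OF this D(1)] obtain x y z where xyz: "x \<in> E" "y \<in> E" "z \<in> E"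
    "less_fun x y" "less_fun y z" "\<forall>u\<in>D. \<not> (less_fun x u \<and> less_fun u z)"
    by blast
  let ?I = "{a \<in> Field ?r. strictly_below ?r (g x) a \<and> strictly_below ?r a (g z)}"
  have "?I \<in> open_intervals ?r"
    unfolding open_intervals_def using xyz(1,3)
    by (intro UnI1 CollectI exI[of _ "g x"] exI[of _ "g z"]) (simp add: Field_lex_image)
  moreover have "g y \<in> ?I"
    using xyz(1-5) by (simp add: Field_lex_image strictly_below_lex_image[OF g])
  then have "?I \<noteq> {}"
    by (simp only: ex_in_conv[symmetric]) (rule exI)
  ultimately have "D' \<inter> ?I \<noteq> {}"
    by (rule D'(3)[rule_format])
  then obtain u where u: "u \<in> D" "g u \<in> ?I"
    unfolding D(2) by (simp only: ex_in_conv[symmetric]) (elim exE IntE imageE, simp)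
  have "u \<in> E"
    using D(1) u(1) by (rule subsetD)
  with u(2) have "less_fun x u" "less_fun u z"
    using xyz(1,3) by (simp_all add: strictly_below_lex_image[OF g])
  with u(1) xyz(6) show False
    by simp
qed

text \<open>A family of pairs is pulled back along \<open>g\<close>. Two of its members that share a
  first or a second entry are equal by disjointness, so both projections are injective.\<close>

lemma two_entangled_lex_image:
  assumes g: "inj_on g E" and "uncountable E"
    and entangled: "\<And>F t. F \<subseteq> E \<times> E \<Longrightarrow> uncountable F \<Longrightarrow> (\<And>x y. (x, y) \<in> F \<Longrightarrow> x \<noteq> y) \<Longrightarrow>
      inj_on fst F \<Longrightarrow> inj_on snd F \<Longrightarrow> \<exists>x y p q. (x, y) \<in> F \<and> (p, q) \<in> F \<and> x \<noteq> p \<and>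
        (less_fun p x, less_fun q y) \<in> {t, neg_type t}"
  shows "two_entangled (lex_image g E)"
  unfolding two_entangled_def Field_lex_image
proof (intro conjI allI impI; (elim conjE)?)
  have "uncountable (g ` E)"
    using \<open>uncountable E\<close> g countable_image_inj_on by blast
  then show "omega1 \<le>o |g ` E|"
    by (simp add: omega1_ordLeq_card_of_iff)
next
  fix F' t
  assume F': "F' \<subseteq> g ` E \<times> g ` E" "|F'| =o omega1" and one_one: "\<forall>e\<in>F'. one_one_pair e"
    and disjoint: "\<forall>e\<in>F'. \<forall>e'\<in>F'. e \<noteq> e' \<longrightarrow> disjoint_pairs e e'"
  define F where "F = {(x, y). x \<in> E \<and> y \<in> E \<and> (g x, g y) \<in> F'}"
  have F'_eq: "F' = map_prod g g ` F"
    using F'(1) unfolding F_def by force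
  have "omega1 \<le>o |F'|"
    using F'(2) ordIso_iff_ordLeq by blast
  then have "uncountable F"
    unfolding omega1_ordLeq_card_of_iff F'_eq by (metis countable_image)
  moreover have "F \<subseteq> E \<times> E"
    by (auto simp: F_def)
  moreover have "x \<noteq> y" if "(x, y) \<in> F" for x y
    using one_one that by (auto simp: F_def one_one_pair_def)
  moreover have "e = e'" if "e \<in> F" "e' \<in> F" "fst e = fst e' \<or> snd e = snd e'" for e e'
  proof -
    obtain x y p q where e: "e = (x, y)" "e' = (p, q)"
      by (cases e, cases e')
    with that have "(g x, g y) \<in> F'" "(g p, g q) \<in> F'" "g x = g p \<or> g y = g q"
      by (auto simp: F_def)
    then have "(g x, g y) = (g p, g q)"
      using disjoint unfolding disjoint_pairs_def by fastforce
    then show ?thesis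
      using that(1,2) g unfolding e by (auto simp: F_def dest: inj_onD)
  qed
  then have "inj_on fst F" "inj_on snd F"
    by (auto intro!: inj_onI)
  ultimately obtain x y p q where xypq: "(x, y) \<in> F" "(p, q) \<in> F" "x \<noteq> p"
    "(less_fun p x, less_fun q y) \<in> {t, neg_type t}"
    using entangled[of F t] by blast
  then have E: "x \<in> E" "y \<in> E" "p \<in> E" "q \<in> E" "(g x, g y) \<in> F'" "(g p, g q) \<in> F'"
    by (auto simp: F_def)
  have "(g x, g y) \<noteq> (g p, g q)"
    using inj_onD[OF g _ E(1,3)] xypq(3) by auto
  moreover have "realize (lex_image g E) (g x, g y) (g p, g q) t"
    using xypq(4) E unfolding realize_def pair_type_def
    by (simp add: strictly_below_lex_image[OF g])
  ultimately show "\<exists>e\<in>F'. \<exists>e'\<in>F'. e \<noteq> e' \<and> realize (lex_image g E) e e' t"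
    using E by blast
qed

section \<open>Coding names and pairs of names by countable ordinals\<close>

lemma infinite_om1: "infinite (UNIV :: om1 set)"
  using uncountable_om1 countable_finite by blast

lemma inj_om1_nat: "\<exists>c :: om1 \<times> nat \<Rightarrow> om1. inj c"
proof -
  have "|UNIV :: nat set| \<le>o |UNIV :: om1 set|"
    using infinite_om1 infinite_iff_card_of_nat by blast
  then have "|(UNIV :: om1 set) \<times> (UNIV :: nat set)| =o |UNIV :: om1 set|"
    using card_of_Times_infinite[OF infinite_om1] by blast
  then have "|UNIV :: (om1 \<times> nat) set| \<le>o |UNIV :: om1 set|"
    using ordIso_iff_ordLeq by auto
  then show ?thesis
    by (auto simp flip: card_of_ordLeq)
qed

lemma inj_om1_om1: "\<exists>c :: om1 \<times> om1 \<Rightarrow> om1. inj c"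
proof -
  have "|(UNIV :: om1 set) \<times> (UNIV :: om1 set)| =o |UNIV :: om1 set|"
    using card_of_Times_same_infinite[OF infinite_om1] .
  then have "|UNIV :: (om1 \<times> om1) set| \<le>o |UNIV :: om1 set|"
    using ordIso_iff_ordLeq by auto
  then show ?thesis
    by (auto simp flip: card_of_ordLeq)
qed

theorem theorem6p1:
  assumes "diamond"
  shows "\<exists>L :: nat set rel. Linear_order L \<and> two_entangled L \<and> \<not> separable_order L"
proof -
  obtain A :: "om1 \<Rightarrow> om1 set" where A: "\<forall>X H. (\<forall>b. countable (H b)) \<longrightarrow>
      (\<exists>d. (\<exists>b. b < d) \<and> (\<forall>b<d. H b \<subseteq> {..<d}) \<and> X \<inter> {..<d} = A d \<inter> {..<d})"
    using diamond_om1[OF assms] by blast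
  obtain c :: "om1 \<times> nat \<Rightarrow> om1" and c' :: "om1 \<times> om1 \<Rightarrow> om1" where c: "inj c" "inj c'"
    using inj_om1_nat inj_om1_om1 by auto
  \<comment> \<open>Each name is coded by \<open>c\<close>, and the resulting pair of ordinals by
    \<open>c'\<close>.\<close>
  define code where "code = c' \<circ> map_prod c c"
  have code: "inj code"
    unfolding code_def using c by (intro inj_compose prod.inj_map)
  obtain f where f: "\<And>d. tree_level (\<lambda>d. code -` A d) f d (f d)"
    using tree_exists[OF countable_lessThan_om1, of "\<lambda>d. code -` A d"] by blast
  define E where "E = range (case_prod f)"
  \<comment> \<open>A node is sent to one of its names, the name to an ordinal by \<open>c\<close>,
    and the ordinal to its representative in \<open>nat set\<close>, the type on which the order is
    to live.\<close>
  define g where "g = Rep_om1 \<circ> c \<circ> inv (case_prod f)"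
  have "inj Rep_om1"
    by (simp add: inj_def Rep_om1_inject)
  then have "inj (Rep_om1 \<circ> c)"
    using c(1) by (rule inj_compose)
  then have Rep_c: "inj_on (Rep_om1 \<circ> c) (inv (case_prod f) ` E)"
    by (rule inj_on_subset) simp
  have "inj_on (inv (case_prod f)) E"
    unfolding E_def by (rule inj_on_inv_into) simp
  then have g: "inj_on g E"
    unfolding g_def using Rep_c by (rule comp_inj_on)
  \<comment> \<open>One node is taken from each level; their heights tell them apart, so there are
    uncountably many.\<close>
  have "height (f a 0) a" for a
    using f[of a] by (simp add: tree_level_def)
  then have "inj (\<lambda>a. f a 0)"
    by (intro injI) (metis height_unique)
  then have "uncountable (range (\<lambda>a. f a 0))"
    using uncountable_om1 by (auto dest: countable_image_inj_on)
  moreover have "range (\<lambda>a. f a 0) \<subseteq> E"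
    by (auto simp: E_def)
  ultimately have "uncountable E"
    using countable_subset by blast
  have "two_entangled (lex_image g E)"
  proof (rule two_entangled_lex_image[OF g \<open>uncountable E\<close>])
    fix F t
    assume F: "F \<subseteq> E \<times> E" "uncountable F" "inj_on fst F" "inj_on snd F"
      and one_one: "\<And>x y. (x, y) \<in> F \<Longrightarrow> x \<noteq> y"
    show "\<exists>x y p q. (x, y) \<in> F \<and> (p, q) \<in> F \<and> x \<noteq> p \<and>
        (less_fun p x, less_fun q y) \<in> {t, neg_type t}"
    proof (rule entangled_of_tree[OF _ code f])
      show "\<exists>d. (\<exists>b. b < d) \<and> (\<forall>b<d. H b \<subseteq> {..<d}) \<and> X \<inter> {..<d} = A d \<inter> {..<d}"
        if "\<forall>b. countable (H b)" for X H
        using A[THEN spec, THEN spec, THEN mp, OF that] .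
    qed (use F one_one in \<open>simp_all add: E_def\<close>)
  qed
  moreover have "\<not> separable_order (lex_image g E)"
    unfolding E_def using gap_of_tree[OF f]
    by (intro not_separable_lex_image[OF g[unfolded E_def]])
  ultimately show ?thesis
    using Linear_order_lex_image[OF g] by (intro exI conjI)
qed

end
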